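(* Let $k$ be a constant and let $\varphi:(M^2,g=dr^2+\sigma^2(r)d\theta^2)\longrightarrow(N^2,h=d\rho^2+\lambda^2(\rho)d\phi^2)$, $\varphi(r,\theta)=(\rho(r),k\theta)$, be any proper biharmonic map with $|\tau(\varphi)|\neq0$ (nowhere zero). Let $C_1,C_2$ be constants with $C_1^2+C_2^2\neq0$ and let $$f=C_1+C_2\int\Big(\rho''+\frac{\sigma'}{\sigma}\rho'-\frac{k^2\lambda(\rho)\lambda'(\rho)}{\sigma^2}\Big)^{-2}\sigma^{-1}\,dr ,$$ where $\int\cdots dr$ denotes an antiderivative, and assume $f>0$. Then $\varphi:(M^2,g)\longrightarrow(N^2,h)$ is a non-harmonic $f$-biharmonic map.
   Context: For a smooth map $\phi:(M,g)\to(N,h)$ of Riemannian manifolds, $\tau(\phi)=\mathrm{Tr}_g\nabla d\phi$ is the tension field and $\tau_2(\phi)=\mathrm{Trace}_g(\nabla^\phi\nabla^\phi-\nabla^\phi_{\nabla^M})\tau(\phi)-\mathrm{Trace}_g R^N(d\phi,\tau(\phi))d\phi$ is the bitension field, with $R^N(X,Y)Z=[\nabla^N_X,\nabla^N_Y]Z-\nabla^N_{[X,Y]}Z$. The map is harmonic if $\tau(\phi)=0$, biharmonic if $\tau_2(\phi)=0$, proper biharmonic if it is biharmonic but not harmonic, and, for a positive smooth function $f$ on $M$, $f$-biharmonic if $f\tau_2(\phi)+(\Delta f)\tau(\phi)+2\nabla^\phi_{\mathrm{grad} f}\tau(\phi)=0$. Here $(r,\theta)$ and $(\rho,\phi)$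 are polar-type coordinates on $M^2$, $N^2$ ($\theta,\phi$ angular), $r$ ranging over an interval; $\sigma$ and $\lambda$ are positive smooth functions of one variable; primes on $\rho,\sigma$ are $d/dr$ and $\lambda'=d\lambda/d\rho$, evaluated at $\rho=\rho(r)$. When $k$ is not an integer the statement is understood in local coordinates (locally in $\theta$). *)

theory Defs
  imports "HOL-Analysis.Analysis"
begin

text \<open>
  Riemannian geometry in coordinate domains: a Riemannian manifold is represented by an open
  set of \<open>real^'m\<close> carrying a matrix-valued function \<open>g\<close>, the Gram matrix of the metric in the
  coordinate frame. Vector fields, and vector fields along a map, are given by their components
  in the coordinate frames.
\<close>

section \<open>Differentiation along vector fields and smoothness\<close>

definition vderiv ::
    "('a::real_normed_vector \<Rightarrow> 'a) \<Rightarrow> ('a \<Rightarrow> 'b::real_normed_vector) \<Rightarrow> 'a \<Rightarrow> 'b" where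
  "vderiv X F x = frechet_derivative F (at x) (X x)"

text \<open>All iterated directional derivatives exist and are differentiable; on an open set this is
  \<open>C\<^sup>\<infinity>\<close>-smoothness.\<close>

definition smooth_on :: "'a::euclidean_space set \<Rightarrow> ('a \<Rightarrow> 'b::real_normed_vector) \<Rightarrow> bool" where
  "smooth_on U F \<longleftrightarrow>
     (\<forall>vs. \<forall>x\<in>U. foldr (\<lambda>v. vderiv (\<lambda>_. v)) vs F differentiable (at x))"

definition coord_field :: "'m::finite \<Rightarrow> real^'m \<Rightarrow> real^'m" where
  "coord_field i = (\<lambda>_. axis i 1)"

definition lie_bracket ::
    "(real^'m \<Rightarrow> real^'m) \<Rightarrow> (real^'m \<Rightarrow> real^'m) \<Rightarrow> real^'m \<Rightarrow> real^'m" where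
  "lie_bracket X Y x = vderiv X Y x - vderiv Y X x"

section \<open>Metrics, connections, curvature\<close>

definition riemannian_domain ::
    "(real^'m) set \<Rightarrow> (real^'m \<Rightarrow> real^'m^'m) \<Rightarrow> bool" where
  "riemannian_domain U g \<longleftrightarrow> open U \<and> smooth_on U g \<and>
     (\<forall>x\<in>U. transpose (g x) = g x \<and> (\<forall>v. v \<noteq> 0 \<longrightarrow> v \<bullet> (g x *v v) > 0))"

definition metric_norm :: "(real^'m \<Rightarrow> real^'m^'m) \<Rightarrow> real^'m \<Rightarrow> real^'m \<Rightarrow> real" where
  "metric_norm g x v = sqrt (v \<bullet> (g x *v v))"

definition metric_trace ::
    "(real^'m \<Rightarrow> real^'m^'m) \<Rightarrow>
     ((real^'m \<Rightarrow> real^'m) \<Rightarrow> (real^'m \<Rightarrow> real^'m) \<Rightarrow> real^'m \<Rightarrow> 'b::real_vector) \<Rightarrow>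
     real^'m \<Rightarrow> 'b" where
  "metric_trace g B x =
     (\<Sum>i\<in>UNIV. \<Sum>j\<in>UNIV. (matrix_inv (g x) $ i $ j) *\<^sub>R B (coord_field i) (coord_field j) x)"

definition christoffel ::
    "(real^'m \<Rightarrow> real^'m^'m) \<Rightarrow> 'm::finite \<Rightarrow> 'm \<Rightarrow> 'm \<Rightarrow> real^'m \<Rightarrow> real" where
  "christoffel g k i j x =
     1/2 * (\<Sum>l\<in>UNIV. matrix_inv (g x) $ k $ l *
       (vderiv (coord_field i) (\<lambda>y. g y $ j $ l) x
        + vderiv (coord_field j) (\<lambda>y. g y $ i $ l) x
        - vderiv (coord_field l) (\<lambda>y. g y $ i $ j) x))"

definition christoffel_form ::
    "(real^'m \<Rightarrow> real^'m^'m) \<Rightarrow> real^'m \<Rightarrow> real^'m \<Rightarrow> real^'m \<Rightarrow> real^'m" where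
  "christoffel_form g x u w =
     (\<chi> k. \<Sum>i\<in>UNIV. \<Sum>j\<in>UNIV. christoffel g k i j x * u $ i * w $ j)"

definition levi_civita ::
    "(real^'m \<Rightarrow> real^'m^'m) \<Rightarrow> (real^'m \<Rightarrow> real^'m) \<Rightarrow> (real^'m \<Rightarrow> real^'m) \<Rightarrow>
     real^'m \<Rightarrow> real^'m" where
  "levi_civita g X Y x = vderiv X Y x + christoffel_form g x (X x) (Y x)"

definition curvature ::
    "(real^'m \<Rightarrow> real^'m^'m) \<Rightarrow> (real^'m \<Rightarrow> real^'m) \<Rightarrow> (real^'m \<Rightarrow> real^'m) \<Rightarrow>
     (real^'m \<Rightarrow> real^'m) \<Rightarrow> real^'m \<Rightarrow> real^'m" where
  "curvature g X Y Z x =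
     levi_civita g X (levi_civita g Y Z) x - levi_civita g Y (levi_civita g X Z) x
     - levi_civita g (lie_bracket X Y) Z x"

text \<open>The curvature is tensorial, so its value on tangent vectors at a point may be computed from
  any extensions to vector fields; we extend with constant components.\<close>

definition curvature_at ::
    "(real^'m \<Rightarrow> real^'m^'m) \<Rightarrow> real^'m \<Rightarrow> real^'m \<Rightarrow> real^'m \<Rightarrow> real^'m \<Rightarrow> real^'m" where
  "curvature_at g x u v w = curvature g (\<lambda>_. u) (\<lambda>_. v) (\<lambda>_. w) x"

definition gradient :: "(real^'m \<Rightarrow> real^'m^'m) \<Rightarrow> (real^'m \<Rightarrow> real) \<Rightarrow> real^'m \<Rightarrow> real^'m" where
  "gradient g f x = matrix_inv (g x) *v (\<chi> i. vderiv (coord_field i) f x)"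

definition laplacian :: "(real^'m \<Rightarrow> real^'m^'m) \<Rightarrow> (real^'m \<Rightarrow> real) \<Rightarrow> real^'m \<Rightarrow> real" where
  "laplacian g f =
     metric_trace g (\<lambda>X Y x. vderiv X (vderiv Y f) x - vderiv (levi_civita g X Y) f x)"

section \<open>Maps between Riemannian domains\<close>

text \<open>The connection on the pullback bundle; here \<open>vderiv X \<phi> x\<close> is \<open>d\<phi>(X)\<close> at \<open>x\<close>.\<close>

definition pullback_conn ::
    "(real^'n \<Rightarrow> real^'n^'n) \<Rightarrow> (real^'m \<Rightarrow> real^'n) \<Rightarrow> (real^'m \<Rightarrow> real^'m) \<Rightarrow>
     (real^'m \<Rightarrow> real^'n) \<Rightarrow> real^'m \<Rightarrow> real^'n" where
  "pullback_conn h \<phi> X V x =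
     vderiv X V x + christoffel_form h (\<phi> x) (vderiv X \<phi> x) (V x)"

definition second_fundamental_form ::
    "(real^'m \<Rightarrow> real^'m^'m) \<Rightarrow> (real^'n \<Rightarrow> real^'n^'n) \<Rightarrow> (real^'m \<Rightarrow> real^'n) \<Rightarrow>
     (real^'m \<Rightarrow> real^'m) \<Rightarrow> (real^'m \<Rightarrow> real^'m) \<Rightarrow> real^'m \<Rightarrow> real^'n" where
  "second_fundamental_form g h \<phi> X Y x =
     pullback_conn h \<phi> X (vderiv Y \<phi>) x - vderiv (levi_civita g X Y) \<phi> x"

definition tension_field ::
    "(real^'m \<Rightarrow> real^'m^'m) \<Rightarrow> (real^'n \<Rightarrow> real^'n^'n) \<Rightarrow> (real^'m \<Rightarrow> real^'n) \<Rightarrow>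
     real^'m \<Rightarrow> real^'n" where
  "tension_field g h \<phi> = metric_trace g (second_fundamental_form g h \<phi>)"

definition bitension_field ::
    "(real^'m \<Rightarrow> real^'m^'m) \<Rightarrow> (real^'n \<Rightarrow> real^'n^'n) \<Rightarrow> (real^'m \<Rightarrow> real^'n) \<Rightarrow>
     real^'m \<Rightarrow> real^'n" where
  "bitension_field g h \<phi> x =
     metric_trace g (\<lambda>X Y z.
       pullback_conn h \<phi> X (pullback_conn h \<phi> Y (tension_field g h \<phi>)) z
       - pullback_conn h \<phi> (levi_civita g X Y) (tension_field g h \<phi>) z) x
     - metric_trace g (\<lambda>X Y z.
       curvature_at h (\<phi> z) (vderiv X \<phi> z) (tension_field g h \<phi> z) (vderiv Y \<phi> z)) x"

definition smooth_riemannian_map ::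
    "(real^'m) set \<Rightarrow> (real^'m \<Rightarrow> real^'m^'m) \<Rightarrow> (real^'n) set \<Rightarrow> (real^'n \<Rightarrow> real^'n^'n) \<Rightarrow>
     (real^'m \<Rightarrow> real^'n) \<Rightarrow> bool" where
  "smooth_riemannian_map U g V h \<phi> \<longleftrightarrow>
     riemannian_domain U g \<and> riemannian_domain V h \<and> smooth_on U \<phi> \<and> \<phi> ` U \<subseteq> V"

definition harmonic_map ::
    "(real^'m) set \<Rightarrow> (real^'m \<Rightarrow> real^'m^'m) \<Rightarrow> (real^'n) set \<Rightarrow> (real^'n \<Rightarrow> real^'n^'n) \<Rightarrow>
     (real^'m \<Rightarrow> real^'n) \<Rightarrow> bool" where
  "harmonic_map U g V h \<phi> \<longleftrightarrow>
     smooth_riemannian_map U g V h \<phi> \<and> (\<forall>x\<in>U. tension_field g h \<phi> x = 0)"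

definition biharmonic_map ::
    "(real^'m) set \<Rightarrow> (real^'m \<Rightarrow> real^'m^'m) \<Rightarrow> (real^'n) set \<Rightarrow> (real^'n \<Rightarrow> real^'n^'n) \<Rightarrow>
     (real^'m \<Rightarrow> real^'n) \<Rightarrow> bool" where
  "biharmonic_map U g V h \<phi> \<longleftrightarrow>
     smooth_riemannian_map U g V h \<phi> \<and> (\<forall>x\<in>U. bitension_field g h \<phi> x = 0)"

definition proper_biharmonic_map ::
    "(real^'m) set \<Rightarrow> (real^'m \<Rightarrow> real^'m^'m) \<Rightarrow> (real^'n) set \<Rightarrow> (real^'n \<Rightarrow> real^'n^'n) \<Rightarrow>
     (real^'m \<Rightarrow> real^'n) \<Rightarrow> bool" where
  "proper_biharmonic_map U g V h \<phi> \<longleftrightarrow> biharmonic_map U g V h \<phi> \<and> \<not> harmonic_map U g V h \<phi>"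

definition f_biharmonic_map ::
    "(real^'m \<Rightarrow> real) \<Rightarrow> (real^'m) set \<Rightarrow> (real^'m \<Rightarrow> real^'m^'m) \<Rightarrow>
     (real^'n) set \<Rightarrow> (real^'n \<Rightarrow> real^'n^'n) \<Rightarrow> (real^'m \<Rightarrow> real^'n) \<Rightarrow> bool" where
  "f_biharmonic_map f U g V h \<phi> \<longleftrightarrow>
     smooth_riemannian_map U g V h \<phi> \<and> smooth_on U f \<and> (\<forall>x\<in>U. f x > 0) \<and>
     (\<forall>x\<in>U. f x *\<^sub>R bitension_field g h \<phi> x
             + laplacian g f x *\<^sub>R tension_field g h \<phi> x
             + 2 *\<^sub>R pullback_conn h \<phi> (gradient g f) (tension_field g h \<phi>) x = 0)"

section \<open>Polar-type coordinates on surfaces\<close>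

text \<open>Points are \<open>(r, \<theta>)\<close>. The angular coordinate is a real number ranging over an interval \<open>J\<close>:
  a bounded \<open>J\<close> describes a local chart, and \<open>J = UNIV\<close> the universal cover of the full
  rotationally symmetric surface.\<close>

definition polar_patch :: "real set \<Rightarrow> real set \<Rightarrow> (real^2) set" where
  "polar_patch I J = {x. x $ 1 \<in> I \<and> x $ 2 \<in> J}"

text \<open>The metric \<open>dr\<^sup>2 + \<sigma>\<^sup>2(r) d\<theta>\<^sup>2\<close>.\<close>

definition polar_metric :: "(real \<Rightarrow> real) \<Rightarrow> real^2 \<Rightarrow> real^2^2" where
  "polar_metric \<sigma> x = vector [vector [1, 0], vector [0, (\<sigma> (x $ 1))\<^sup>2]]"

definition polar_map :: "(real \<Rightarrow> real) \<Rightarrow> real \<Rightarrow> real^2 \<Rightarrow> real^2" where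
  "polar_map \<rho> k x = vector [\<rho> (x $ 1), k * x $ 2]"

end

theory Submission
  imports Defs
begin

text \<open>
  Write \<open>y = \<rho>'' + \<sigma>' \<rho>' / \<sigma> - k\<^sup>2 \<lambda>(\<rho>) \<lambda>'(\<rho>) / \<sigma>\<^sup>2\<close>. The tension field of \<open>(r, \<theta>) \<mapsto> (\<rho>(r), k \<theta>)\<close>
  is \<open>y(r) \<partial>\<^sub>\<rho>\<close>: its angular component vanishes because \<open>k \<theta>\<close> is a harmonic function on the domain
  and \<open>d\<phi>\<close> maps the orthogonal coordinate frame to multiples of the orthogonal coordinate frame, on
  which the mixed Christoffel symbols of the target do not contribute to the trace
  (\<open>tension_field_polar_map\<close>).

  Since the bitension field is zero, \<open>f\<close>-biharmonicity reduces to
  \<open>(\<Delta>f) \<tau> + 2 \<nabla>\<^bsub>grad f\<^esub> \<tau> = 0\<close>. For a function \<open>f = G(r)\<close> the gradient is \<open>G' \<partial>\<^sub>r\<close>, and the radial curves of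
  the target are geodesics, so that \<open>\<partial>\<^sub>\<rho>\<close> is parallel along the images of the curves of constant
  \<open>\<theta>\<close>. Hence the equation has only a \<open>\<partial>\<^sub>\<rho>\<close>-component, namely
  \<open>(G'' + \<sigma>' G' / \<sigma>) y + 2 G' y' = 0\<close> (\<open>f_biharmonic_first_order_part\<close>). Multiplied by \<open>\<sigma> y\<close> it reads
  \<open>(\<sigma> y\<^sup>2 G')' = 0\<close>, so its solutions are given by \<open>G' = c y\<^sup>-\<^sup>2 \<sigma>\<^sup>-\<^sup>1\<close> (\<open>radial_ode_solution\<close>), which is
  exactly the assumption on \<open>f\<close>.

  What remains is that \<open>f\<close> is smooth. Its radial derivative is built from \<open>\<sigma>\<close>, \<open>\<rho>\<close>, \<open>\<lambda>\<close> and their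
  derivatives by sums, products, reciprocals and composition, so it suffices that smooth functions
  of one variable are closed under these operations.
\<close>

section \<open>Iterated differentiability in one variable\<close>

text \<open>Quantifying over some derivative on \<open>I\<close>, in place of fixing it as \<open>deriv u\<close>, makes the closure
  properties below plain inductions: the derivative may be supplied by any formula that is correct
  on \<open>I\<close>, whatever its values elsewhere.\<close>

fun times_differentiable_on :: "nat \<Rightarrow> real set \<Rightarrow> (real \<Rightarrow> real) \<Rightarrow> bool" where
  "times_differentiable_on 0 I u \<longleftrightarrow> True"
| "times_differentiable_on (Suc n) I u \<longleftrightarrow>
     (\<exists>u'. (\<forall>r\<in>I. (u has_real_derivative u' r) (at r)) \<and> times_differentiable_on n I u')"

lemma times_differentiable_on_SucD:
  "times_differentiable_on (Suc n) I u \<Longrightarrow> times_differentiable_on n I u"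
  by (induction n arbitrary: u) fastforce+

lemma times_differentiable_on_const [simp]: "times_differentiable_on n I (\<lambda>_. c)"
proof (induction n arbitrary: c)
  case (Suc n)
  have "\<forall>r\<in>I. ((\<lambda>_. c) has_real_derivative 0) (at r)" by simp
  with Suc[of 0] show ?case by (auto intro!: exI[of _ "\<lambda>_. 0"])
qed simp

lemma times_differentiable_on_add:
  assumes "times_differentiable_on n I u" "times_differentiable_on n I v"
  shows "times_differentiable_on n I (\<lambda>r. u r + v r)"
  using assms
proof (induction n arbitrary: u v)
  case (Suc n)
  then obtain u' v'
    where d: "\<forall>r\<in>I. (u has_real_derivative u' r) (at r)" "times_differentiable_on n I u'"
             "\<forall>r\<in>I. (v has_real_derivative v' r) (at r)" "times_differentiable_on n I v'" by auto
  have "\<forall>r\<in>I. ((\<lambda>r. u r + v r) has_real_derivative u' r + v' r) (at r)"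
    using d by (auto intro!: derivative_eq_intros)
  moreover have "times_differentiable_on n I (\<lambda>r. u' r + v' r)"
    using d Suc.IH by blast
  ultimately show ?case by auto
qed simp

lemma times_differentiable_on_mult:
  assumes "times_differentiable_on n I u" "times_differentiable_on n I v"
  shows "times_differentiable_on n I (\<lambda>r. u r * v r)"
  using assms
proof (induction n arbitrary: u v)
  case (Suc n)
  then obtain u' v'
    where d: "\<forall>r\<in>I. (u has_real_derivative u' r) (at r)" "times_differentiable_on n I u'"
             "\<forall>r\<in>I. (v has_real_derivative v' r) (at r)" "times_differentiable_on n I v'" by auto
  have "\<forall>r\<in>I. ((\<lambda>r. u r * v r) has_real_derivative u' r * v r + u r * v' r) (at r)"
    using d by (auto intro!: derivative_eq_intros)
  moreover have "times_differentiable_on n I (\<lambda>r. u' r * v r + u r * v' r)"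
    using d Suc.IH Suc.prems[THEN times_differentiable_on_SucD]
    by (intro times_differentiable_on_add) auto
  ultimately show ?case by fastforce
qed simp

lemma times_differentiable_on_compose:
  assumes "times_differentiable_on n K v" "times_differentiable_on n I u" "u ` I \<subseteq> K"
  shows "times_differentiable_on n I (\<lambda>r. v (u r))"
  using assms(1,2)
proof (induction n arbitrary: v)
  case (Suc n)
  then obtain u' v'
    where d: "\<forall>r\<in>I. (u has_real_derivative u' r) (at r)" "times_differentiable_on n I u'"
             "\<forall>s\<in>K. (v has_real_derivative v' s) (at s)" "times_differentiable_on n K v'" by auto
  have "\<forall>r\<in>I. ((\<lambda>r. v (u r)) has_real_derivative v' (u r) * u' r) (at r)"
    using d assms(3) by (blast intro: DERIV_chain2)
  moreover have "times_differentiable_on n I (\<lambda>r. v' (u r) * u' r)"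
    using d Suc.IH Suc.prems(2)[THEN times_differentiable_on_SucD]
    by (intro times_differentiable_on_mult) auto
  ultimately show ?case by fastforce
qed simp

lemma times_differentiable_on_inverse:
  assumes "times_differentiable_on n I u" "\<forall>r\<in>I. u r \<noteq> 0"
  shows "times_differentiable_on n I (\<lambda>r. inverse (u r))"
  using assms(1)
proof (induction n)
  case (Suc n)
  then obtain u'
    where d: "\<forall>r\<in>I. (u has_real_derivative u' r) (at r)" "times_differentiable_on n I u'" by auto
  have "\<forall>r\<in>I. ((\<lambda>r. inverse (u r)) has_real_derivative
                  (-1) * u' r * (inverse (u r) * inverse (u r))) (at r)"
    using d assms(2) by (auto intro!: derivative_eq_intros)
  moreover have "times_differentiable_on n I (\<lambda>r. (-1) * u' r * (inverse (u r) * inverse (u r)))"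
    using d(2) Suc.IH Suc.prems[THEN times_differentiable_on_SucD]
    by (intro times_differentiable_on_mult times_differentiable_on_const) auto
  ultimately show ?case
    unfolding times_differentiable_on.simps
    by (intro exI[of _ "\<lambda>r. (-1) * u' r * (inverse (u r) * inverse (u r))"] conjI)
qed simp

lemma times_differentiable_on_cong:
  assumes "open I" "\<forall>r\<in>I. u r = v r" "times_differentiable_on n I u"
  shows "times_differentiable_on n I v"
proof (cases n)
  case (Suc m)
  with assms(3) obtain u'
    where d: "\<forall>r\<in>I. (u has_real_derivative u' r) (at r)" "times_differentiable_on m I u'" by auto
  have "\<forall>r\<in>I. (v has_real_derivative u' r) (at r)"
    using d(1) assms(1,2) by (auto intro: has_field_derivative_transform_within_open)
  with d(2) Suc show ?thesis by auto
qed simp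

lemma times_differentiable_on_deriv:
  assumes "open I" "times_differentiable_on (Suc n) I u"
  shows "times_differentiable_on n I (deriv u)"
proof -
  from assms(2) obtain u'
    where d: "\<forall>r\<in>I. (u has_real_derivative u' r) (at r)" "times_differentiable_on n I u'" by auto
  from d(1) have "\<forall>r\<in>I. u' r = deriv u r" by (auto simp: DERIV_imp_deriv)
  from times_differentiable_on_cong[OF assms(1) this d(2)] show ?thesis .
qed

lemma times_differentiable_on_imp_DERIV:
  assumes "times_differentiable_on (Suc n) I u" "r \<in> I"
  shows "(u has_real_derivative deriv u r) (at r)"
  using assms by (auto simp: DERIV_imp_deriv)

text \<open>On the real line a directional derivative in direction \<open>1\<close> is the ordinary derivative, and
  smoothness passes to it because the list of directions may be extended on the right.\<close>

lemma smooth_on_imp_times_differentiable_on: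
  "smooth_on I u \<Longrightarrow> times_differentiable_on n I u"
proof (induction n arbitrary: u)
  case (Suc n)
  let ?u' = "vderiv (\<lambda>_. 1) u"
  have "\<forall>r\<in>I. (u has_real_derivative ?u' r) (at r)"
  proof
    fix r assume "r \<in> I"
    with Suc.prems have "u differentiable (at r)"
      unfolding smooth_on_def by (auto dest!: spec[of _ "[]"])
    then have d: "(u has_derivative frechet_derivative u (at r)) (at r)"
      by (simp add: frechet_derivative_works)
    then obtain c where "frechet_derivative u (at r) = (\<lambda>t. t * c)"
      using real_bounded_linear has_derivative_bounded_linear by blast
    with d show "(u has_real_derivative ?u' r) (at r)"
      by (simp add: vderiv_def has_field_derivative_def mult.commute[of _ c])
  qed
  moreover have "smooth_on I ?u'"
    unfolding smooth_on_def
  proof (intro allI ballI)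
    fix vs :: "real list" and r assume "r \<in> I"
    with Suc.prems have "foldr (\<lambda>v. vderiv (\<lambda>_. v)) (vs @ [1]) u differentiable (at r)"
      unfolding smooth_on_def by blast
    then show "foldr (\<lambda>v. vderiv (\<lambda>_. v)) vs ?u' differentiable (at r)" by simp
  qed
  ultimately show ?case using Suc.IH by auto
qed simp

section \<open>Functions and fields depending on single coordinates\<close>

lemma vderiv_eq: "(F has_derivative F') (at x) \<Longrightarrow> vderiv X F x = F' (X x)"
  by (simp add: vderiv_def frechet_derivative_at[symmetric])

lemma has_derivative_coordinate:
  fixes x :: "real^'m"
  assumes "(G has_real_derivative G') (at (x $ i))"
  shows "((\<lambda>y. G (y $ i)) has_derivative (\<lambda>v. v $ i * G')) (at x)"
proof -
  have "((\<lambda>y::real^'m. y $ i) has_derivative (\<lambda>v. v $ i)) (at x)"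
    by (intro bounded_linear_imp_has_derivative bounded_linear_vec_nth)
  from has_derivative_compose[OF this assms[unfolded has_field_derivative_def]]
  show ?thesis by (simp add: mult.commute[of G'])
qed

text \<open>Each directional derivative of a function of the coordinate \<open>x $ i\<close> alone is again such a
  function on \<open>U\<close>, with one order of differentiability less.\<close>

lemma smooth_on_coordinate:
  fixes U :: "(real^'m) set"
  assumes U: "open U" "\<forall>x\<in>U. x $ i \<in> I" and G: "\<And>n. times_differentiable_on n I G"
  shows "smooth_on U (\<lambda>x. G (x $ i))"
proof -
  have *: "\<exists>H. times_differentiable_on n I H \<and>
        (\<forall>x\<in>U. foldr (\<lambda>v. vderiv (\<lambda>_. v)) vs (\<lambda>x. G (x $ i)) x = H (x $ i))" for n vs
  proof (induction vs arbitrary: n)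
    case Nil
    then show ?case using G by auto
  next
    case (Cons v vs)
    let ?D = "foldr (\<lambda>v. vderiv (\<lambda>_. v)) vs (\<lambda>x. G (x $ i))"
    obtain H where H: "times_differentiable_on (Suc n) I H" "\<forall>x\<in>U. ?D x = H (x $ i)"
      using Cons.IH by blast
    then obtain H' where H': "\<forall>r\<in>I. (H has_real_derivative H' r) (at r)"
      "times_differentiable_on n I H'" by auto
    have "vderiv (\<lambda>_. v) ?D x = v $ i * H' (x $ i)" if "x \<in> U" for x
    proof (rule vderiv_eq)
      have "((\<lambda>y. H (y $ i)) has_derivative (\<lambda>w. w $ i * H' (x $ i))) (at x)"
        using H' U that by (intro has_derivative_coordinate) auto
      then show "(?D has_derivative (\<lambda>w. w $ i * H' (x $ i))) (at x)"
        by (rule has_derivative_transform_within_open[OF _ U(1) that]) (use H in auto)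
    qed
    moreover have "times_differentiable_on n I (\<lambda>r. v $ i * H' r)"
      using H' by (intro times_differentiable_on_mult) auto
    ultimately show ?case by (intro exI[of _ "\<lambda>r. v $ i * H' r"]) simp
  qed
  show ?thesis
    unfolding smooth_on_def
  proof (intro allI ballI)
    fix vs x assume x: "x \<in> U"
    let ?D = "foldr (\<lambda>v. vderiv (\<lambda>_. v)) vs (\<lambda>x. G (x $ i))"
    obtain H where H: "times_differentiable_on (Suc 0) I H" "\<forall>x\<in>U. ?D x = H (x $ i)"
      using * by blast
    then obtain c where "(H has_real_derivative c) (at (x $ i))" using U x by auto
    from has_derivative_coordinate[OF this]
    have "(?D has_derivative (\<lambda>w. w $ i * c)) (at x)"
      by (rule has_derivative_transform_within_open[OF _ U(1) x]) (use H in auto)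
    then show "?D differentiable (at x)" by (rule differentiableI)
  qed
qed

lemma vderiv_coordinate:
  fixes x :: "real^'m"
  assumes "open U" "x \<in> U" "\<forall>y\<in>U. Q y = G (y $ i)" "(G has_real_derivative G') (at (x $ i))"
  shows "vderiv X Q x = X x $ i * G'"
  by (rule vderiv_eq, rule has_derivative_transform_within_open
      [OF has_derivative_coordinate[OF assms(4)] assms(1,2)]) (use assms(3) in auto)

lemma has_derivative_vector_2:
  fixes A B :: "'a::real_normed_vector \<Rightarrow> real"
  assumes "(A has_derivative A') (at x)" "(B has_derivative B') (at x)"
  shows "((\<lambda>y. vector [A y, B y] :: real^2) has_derivative (\<lambda>v. vector [A' v, B' v])) (at x)"
proof -
  have *: "(vector [a, b] :: real^2) = a *\<^sub>R axis 1 1 + b *\<^sub>R axis 2 1" for a b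
    by (simp add: vec_eq_iff forall_2 axis_def)
  show ?thesis unfolding * using assms by (auto intro!: derivative_eq_intros)
qed

lemma vderiv_vector_coordinates:
  fixes x :: "real^2"
  assumes "open U" "x \<in> U" "\<forall>y\<in>U. Q y = vector [A (y $ 1), B (y $ 2)]"
    "(A has_real_derivative A') (at (x $ 1))" "(B has_real_derivative B') (at (x $ 2))"
  shows "vderiv X Q x = (vector [X x $ 1 * A', X x $ 2 * B'] :: real^2)"
  by (rule vderiv_eq, rule has_derivative_transform_within_open
      [OF has_derivative_vector_2[OF assms(4,5)[THEN has_derivative_coordinate]] assms(1,2)])
    (use assms(3) in auto)

section \<open>Geometry of the metric \<open>dr\<^sup>2 + s\<^sup>2(r) d\<theta>\<^sup>2\<close>\<close>

lemma matrix_inv_unique: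
  fixes A :: "'a::semiring_1^'n^'m"
  assumes "A ** B = mat 1" "B ** A = mat 1"
  shows "matrix_inv A = B"
proof -
  have "A ** matrix_inv A = mat 1 \<and> matrix_inv A ** A = mat 1"
    unfolding matrix_inv_def by (rule someI) (use assms in blast)
  then show ?thesis by (metis assms(2) matrix_mul_assoc matrix_mul_lid matrix_mul_rid)
qed

lemma matrix_inv_polar_metric:
  assumes "s (x $ 1) \<noteq> 0"
  shows "matrix_inv (polar_metric s x) = vector [vector [1, 0], vector [0, 1 / (s (x $ 1))\<^sup>2]]"
  using assms
  by (intro matrix_inv_unique)
    (simp_all add: polar_metric_def matrix_matrix_mult_def vec_eq_iff forall_2 sum_2 mat_def)

lemma metric_trace_polar_metric:
  assumes "s (x $ 1) \<noteq> 0"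
  shows "metric_trace (polar_metric s) B x =
    B (coord_field 1) (coord_field 1) x
    + (1 / (s (x $ 1))\<^sup>2) *\<^sub>R B (coord_field 2) (coord_field 2) x"
  using assms by (simp add: metric_trace_def matrix_inv_polar_metric sum_2)

lemma vderiv_polar_metric:
  assumes "(s has_real_derivative s') (at (x $ 1))"
  shows "vderiv (coord_field i) (\<lambda>y. polar_metric s y $ j $ l) x =
    (if i = 1 \<and> j = 2 \<and> l = 2 then 2 * s (x $ 1) * s' else 0)"
proof -
  have d: "((\<lambda>r. (s r)\<^sup>2) has_real_derivative 2 * s (x $ 1) * s') (at (x $ 1))"
    using assms by (auto intro!: derivative_eq_intros)
  have 22: "vderiv (coord_field i) (\<lambda>y. polar_metric s y $ 2 $ 2) x =
      (if i = 1 then 2 * s (x $ 1) * s' else 0)"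
    by (subst vderiv_coordinate[OF open_UNIV UNIV_I _ d])
      (auto simp: polar_metric_def coord_field_def axis_def)
  have const: "vderiv X (\<lambda>y. c) x = 0" for X :: "real^2 \<Rightarrow> real^2" and c :: real
    using vderiv_eq[OF has_derivative_const] .
  show ?thesis
    using exhaust_2[of j] exhaust_2[of l] 22 by (auto simp: polar_metric_def const)
qed

text \<open>The only nonzero derivative of the metric is \<open>\<partial>\<^sub>r g\<^sub>2\<^sub>2 = 2 s s'\<close>, which leaves
  \<open>\<Gamma>\<^sup>1\<^sub>2\<^sub>2 = - s s'\<close> and \<open>\<Gamma>\<^sup>2\<^sub>1\<^sub>2 = \<Gamma>\<^sup>2\<^sub>2\<^sub>1 = s' / s\<close>.\<close>

lemma christoffel_form_polar_metric:
  assumes s: "(s has_real_derivative s') (at (x $ 1))" "s (x $ 1) \<noteq> 0"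
  shows "christoffel_form (polar_metric s) x u w =
    vector [- (s (x $ 1) * s' * u $ 2 * w $ 2),
            s' / s (x $ 1) * (u $ 1 * w $ 2 + u $ 2 * w $ 1)]"
  using s(2)
  by (simp add: christoffel_form_def christoffel_def matrix_inv_polar_metric sum_2 vec_eq_iff
      forall_2 vderiv_polar_metric[OF s(1)] power2_eq_square field_simps)


lemma gradient_polar_metric:
  assumes "s (x $ 1) \<noteq> 0" "(G has_real_derivative G') (at (x $ 1))"
  shows "gradient (polar_metric s) (\<lambda>y. G (y $ 1)) x = vector [G', 0]"
proof -
  have "vderiv X (\<lambda>y. G (y $ 1)) x = X x $ 1 * G'" for X
    by (rule vderiv_eq[OF has_derivative_coordinate[OF assms(2)]])
  then show ?thesis
    using assms(1)
    by (simp add: gradient_def matrix_inv_polar_metric vec_eq_iff forall_2 coord_field_def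
        matrix_vector_mult_def sum_2 axis_def)
qed

lemma levi_civita_const:
  "levi_civita g X (\<lambda>_. v) x = christoffel_form g x (X x) v"
  using vderiv_eq[OF has_derivative_const, of X v x] by (simp add: levi_civita_def)

lemma open_vec_nth_vimage: "open I \<Longrightarrow> open {y::real^'m. y $ i \<in> I}"
  using open_vimage[of I "\<lambda>y::real^'m. y $ i"] by (simp add: vimage_def continuous_on_component)

text \<open>The first-order term comes from \<open>\<nabla>\<^bsub>\<partial>\<theta>\<^esub> \<partial>\<theta> = - s s' \<partial>r\<close>, weighted in the trace by \<open>s\<^sup>-\<^sup>2\<close>.\<close>

lemma laplacian_polar_metric:
  assumes I: "open I" "x $ 1 \<in> I"
    and s: "(s has_real_derivative s') (at (x $ 1))" "s (x $ 1) \<noteq> 0"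
    and G: "\<forall>r\<in>I. (G has_real_derivative G' r) (at r)" "(G' has_real_derivative G'') (at (x $ 1))"
  shows "laplacian (polar_metric s) (\<lambda>y. G (y $ 1)) x = G'' + s' / s (x $ 1) * G' (x $ 1)"
proof -
  let ?f = "\<lambda>y::real^2. G (y $ 1)"
  have d: "vderiv X ?f y = X y $ 1 * G' (y $ 1)" if "y $ 1 \<in> I" for X y
    using G(1) that by (intro vderiv_eq has_derivative_coordinate) auto
  have dd: "vderiv X (vderiv (\<lambda>_. v) ?f) x = X x $ 1 * (v $ 1 * G'')" for X v
    by (rule vderiv_coordinate[OF open_vec_nth_vimage[OF I(1), of 1],
          where G = "\<lambda>r. v $ 1 * G' r"])
      (use d I(2) G(2) in \<open>auto intro!: derivative_eq_intros\<close>)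
  show ?thesis
    using s(2)
    by (simp add: laplacian_def metric_trace_polar_metric coord_field_def dd d[OF I(2)]
        levi_civita_const christoffel_form_polar_metric[OF s] axis_def power2_eq_square)
qed

lemma vderiv_radial_field:
  fixes x :: "real^2"
  assumes "open I" "x $ 1 \<in> I" "\<And>y. y $ 1 \<in> I \<Longrightarrow> Q y = vector [a (y $ 1), b]"
    "(a has_real_derivative a') (at (x $ 1))"
  shows "vderiv X Q x = (vector [X x $ 1 * a', 0] :: real^2)"
  using vderiv_vector_coordinates[OF open_vec_nth_vimage[OF assms(1), of 1], of x Q a "\<lambda>_. b" a' 0 X]
    assms by simp

section \<open>Maps \<open>(r, \<theta>) \<mapsto> (\<rho>(r), k \<theta>)\<close>\<close>

locale polar_map_data =
  fixes I K :: "real set" and \<sigma> lam \<rho> :: "real \<Rightarrow> real" and k :: real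
  assumes open_I: "open I" and open_K: "open K"
    and smooth: "times_differentiable_on n I \<sigma>" "times_differentiable_on n I \<rho>"
      "times_differentiable_on n K lam"
    and pos: "r \<in> I \<Longrightarrow> \<sigma> r > 0" "s \<in> K \<Longrightarrow> lam s > 0"
    and maps_to: "\<rho> ` I \<subseteq> K"
begin

abbreviation "g \<equiv> polar_metric \<sigma>"
abbreviation "h \<equiv> polar_metric lam"
abbreviation "\<phi> \<equiv> polar_map \<rho> k"

definition radial_tension :: "real \<Rightarrow> real" where
  "radial_tension r = deriv (deriv \<rho>) r + deriv \<sigma> r / \<sigma> r * deriv \<rho> r
     - k\<^sup>2 * lam (\<rho> r) * deriv lam (\<rho> r) / (\<sigma> r)\<^sup>2"

lemma DERIVs:
  assumes "r \<in> I"
  shows "(\<sigma> has_real_derivative deriv \<sigma> r) (at r)"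
    "(\<rho> has_real_derivative deriv \<rho> r) (at r)"
    "(deriv \<rho> has_real_derivative deriv (deriv \<rho>) r) (at r)"
    "(lam has_real_derivative deriv lam (\<rho> r)) (at (\<rho> r))"
proof -
  have "\<rho> r \<in> K" using assms maps_to by auto
  then show "(\<sigma> has_real_derivative deriv \<sigma> r) (at r)"
    "(\<rho> has_real_derivative deriv \<rho> r) (at r)"
    "(deriv \<rho> has_real_derivative deriv (deriv \<rho>) r) (at r)"
    "(lam has_real_derivative deriv lam (\<rho> r)) (at (\<rho> r))"
    using assms smooth times_differentiable_on_deriv[OF open_I smooth(2)]
    by (blast intro: times_differentiable_on_imp_DERIV)+
qed

lemma times_differentiable_on_radial_tension:
  "times_differentiable_on n I radial_tension"
proof -
  have 1: "times_differentiable_on n I (deriv \<sigma>)" "times_differentiable_on n I (deriv \<rho>)"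
    "times_differentiable_on n I (deriv (deriv \<rho>))" "times_differentiable_on n K (deriv lam)"
    by (intro times_differentiable_on_deriv open_I open_K smooth)+
  have 2: "times_differentiable_on n I (\<lambda>r. lam (\<rho> r))"
    "times_differentiable_on n I (\<lambda>r. deriv lam (\<rho> r))"
    by (rule times_differentiable_on_compose[OF _ smooth(2) maps_to], fact smooth 1)+
  have 3: "times_differentiable_on n I (\<lambda>r. inverse (\<sigma> r))"
    by (rule times_differentiable_on_inverse[OF smooth(1)]) (use pos(1) in force)
  have "times_differentiable_on n I (\<lambda>r. deriv (deriv \<rho>) r + (deriv \<sigma> r * inverse (\<sigma> r) * deriv \<rho> r
      + (- k\<^sup>2) * (lam (\<rho> r) * deriv lam (\<rho> r) * (inverse (\<sigma> r) * inverse (\<sigma> r)))))"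
    by (intro times_differentiable_on_add times_differentiable_on_mult times_differentiable_on_const
        1 2 3)
  then show ?thesis
    by (rule times_differentiable_on_cong[OF open_I, rotated])
      (auto simp: radial_tension_def divide_inverse power2_eq_square)
qed

lemma vderiv_polar_map:
  assumes "x $ 1 \<in> I"
  shows "vderiv X \<phi> x = vector [X x $ 1 * deriv \<rho> (x $ 1), X x $ 2 * k]"
  by (rule vderiv_vector_coordinates[OF open_UNIV UNIV_I, where B = "\<lambda>t. k * t"])
    (use DERIVs[OF assms] in \<open>auto simp: polar_map_def intro!: derivative_eq_intros\<close>)

text \<open>Every field whose covariant derivative is needed is of this form: for \<open>d\<phi>\<close> applied to a constant
  field, \<open>b\<close> is a multiple of \<open>k\<close>; for the tension field, \<open>b = 0\<close>.\<close>

lemma pullback_conn_radial_field: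
  assumes "x $ 1 \<in> I" "\<And>y. y $ 1 \<in> I \<Longrightarrow> V y = vector [a (y $ 1), b]"
    "(a has_real_derivative a') (at (x $ 1))"
  shows "pullback_conn h \<phi> X V x =
    vector [X x $ 1 * a' - X x $ 2 * k * b * lam (\<rho> (x $ 1)) * deriv lam (\<rho> (x $ 1)),
            deriv lam (\<rho> (x $ 1)) / lam (\<rho> (x $ 1)) *
              (X x $ 1 * deriv \<rho> (x $ 1) * b + X x $ 2 * k * a (x $ 1))]"
proof -
  have x: "\<phi> x $ 1 = \<rho> (x $ 1)" by (simp add: polar_map_def)
  have "\<rho> (x $ 1) \<in> K" using assms(1) maps_to by auto
  then have "lam (\<rho> (x $ 1)) \<noteq> 0" using pos(2) by force
  then show ?thesis
    using DERIVs(4)[OF assms(1)]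
    by (simp add: pullback_conn_def vderiv_radial_field[OF open_I assms] vderiv_polar_map
        christoffel_form_polar_metric x assms(1,2) vec_eq_iff forall_2)
qed

text \<open>The three terms of \<open>radial_tension\<close> arise separately: \<open>\<rho>''\<close> from the direction \<open>\<partial>r\<close>,
  \<open>\<sigma>' \<rho>' / \<sigma>\<close> from the connection of the domain in the direction \<open>\<partial>\<theta>\<close>, and the \<open>k\<^sup>2\<close>-term from the
  connection of the target in that direction.\<close>

lemma tension_field_polar_map:
  assumes x: "x $ 1 \<in> I"
  shows "tension_field g h \<phi> x = vector [radial_tension (x $ 1), 0]"
proof -
  have \<sigma>: "\<sigma> (x $ 1) \<noteq> 0" using pos(1)[OF x] by simp
  have conn: "pullback_conn h \<phi> X (vderiv (\<lambda>_. v) \<phi>) x =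
      vector [X x $ 1 * (v $ 1 * deriv (deriv \<rho>) (x $ 1))
                - X x $ 2 * k * (v $ 2 * k) * lam (\<rho> (x $ 1)) * deriv lam (\<rho> (x $ 1)),
              deriv lam (\<rho> (x $ 1)) / lam (\<rho> (x $ 1)) *
                (X x $ 1 * deriv \<rho> (x $ 1) * (v $ 2 * k)
                 + X x $ 2 * k * (v $ 1 * deriv \<rho> (x $ 1)))]" for X v
    by (rule pullback_conn_radial_field[OF x])
      (use DERIVs(3)[OF x] in \<open>auto simp: vderiv_polar_map intro!: derivative_eq_intros\<close>)
  show ?thesis
    using \<sigma>
    by (simp add: tension_field_def metric_trace_polar_metric second_fundamental_form_def
        coord_field_def conn vderiv_polar_map[OF x] levi_civita_const
        christoffel_form_polar_metric[OF DERIVs(1)[OF x] \<sigma>] axis_def radial_tension_def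
        vec_eq_iff forall_2 power2_eq_square field_simps)
qed

text \<open>This is the \<open>f\<close>-biharmonic equation without its term \<open>f \<tau>\<^sub>2\<close>. The angular component vanishes
  since neither the gradient nor the tension field has one.\<close>

lemma f_biharmonic_first_order_part:
  assumes x: "x $ 1 \<in> I"
    and G: "\<forall>r\<in>I. (G has_real_derivative G' r) (at r)" "(G' has_real_derivative G'') (at (x $ 1))"
  shows "laplacian g (\<lambda>y. G (y $ 1)) x *\<^sub>R tension_field g h \<phi> x
      + 2 *\<^sub>R pullback_conn h \<phi> (gradient g (\<lambda>y. G (y $ 1))) (tension_field g h \<phi>) x =
    vector [(G'' + deriv \<sigma> (x $ 1) / \<sigma> (x $ 1) * G' (x $ 1)) * radial_tension (x $ 1)
             + 2 * (G' (x $ 1) * deriv radial_tension (x $ 1)), 0]"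
proof -
  have \<sigma>: "\<sigma> (x $ 1) \<noteq> 0" using pos(1)[OF x] by simp
  have \<tau>: "(radial_tension has_real_derivative deriv radial_tension (x $ 1)) (at (x $ 1))"
    using times_differentiable_on_imp_DERIV[OF times_differentiable_on_radial_tension x] .
  have "(G has_real_derivative G' (x $ 1)) (at (x $ 1))" using G(1) x by blast
  with \<sigma> have grad: "gradient g (\<lambda>y. G (y $ 1)) x = vector [G' (x $ 1), 0]"
    by (rule gradient_polar_metric)
  show ?thesis
    by (simp add: laplacian_polar_metric[OF open_I x DERIVs(1)[OF x] \<sigma> G] grad
        pullback_conn_radial_field[OF x tension_field_polar_map \<tau>] tension_field_polar_map[OF x]
        vec_eq_iff forall_2)
qed

end

section \<open>The radial equation and the theorem\<close>

text \<open>The equation is that of \<open>f_biharmonic_first_order_part\<close>. After multiplication by \<open>s y\<close> it says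
  that \<open>s y\<^sup>2 p\<close> is constant, where \<open>p\<close> is the radial derivative of the function sought; the
  function differentiated here is the \<open>p\<close> for which that constant is \<open>c\<close>.\<close>

lemma radial_ode_solution:
  fixes y s :: "real \<Rightarrow> real"
  assumes "(y has_real_derivative y') (at r)" "(s has_real_derivative s') (at r)"
    "y r \<noteq> 0" "s r \<noteq> 0"
  obtains p' where "((\<lambda>r. c * (inverse (y r * y r) * inverse (s r))) has_real_derivative p') (at r)"
    "(p' + s' / s r * (c * (inverse (y r * y r) * inverse (s r)))) * y r
       + 2 * (c * (inverse (y r * y r) * inverse (s r)) * y') = 0"
proof
  show "((\<lambda>r. c * (inverse (y r * y r) * inverse (s r))) has_real_derivative
      c * (- 2 * y' / (y r ^ 3 * s r) - s' / ((y r)\<^sup>2 * (s r)\<^sup>2))) (at r)"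
    using assms by (auto intro!: derivative_eq_intros simp: field_simps power2_eq_square power3_eq_cube)
  show "(c * (- 2 * y' / (y r ^ 3 * s r) - s' / ((y r)\<^sup>2 * (s r)\<^sup>2))
        + s' / s r * (c * (inverse (y r * y r) * inverse (s r)))) * y r
       + 2 * (c * (inverse (y r * y r) * inverse (s r)) * y') = 0"
    using assms(3,4) by (simp add: field_simps power2_eq_square power3_eq_cube)
qed

theorem corollary2p7:
  fixes I J K L :: "real set"
    and \<sigma> lam \<rho> F :: "real \<Rightarrow> real"
    and k C1 C2 :: real
    and M N :: "(real^2) set"
    and g h :: "real^2 \<Rightarrow> real^2^2"
    and \<phi> :: "real^2 \<Rightarrow> real^2"
    and f :: "real^2 \<Rightarrow> real"
  assumes intervals: "open I" "is_interval I" "open J" "is_interval J"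
      "open K" "is_interval K" "open L" "is_interval L"
    and sigma: "smooth_on I \<sigma>" "\<forall>r\<in>I. \<sigma> r > 0"
    and lam: "smooth_on K lam" "\<forall>s\<in>K. lam s > 0"
    and M: "M = polar_patch I J" "g = polar_metric \<sigma>"
    and N: "N = polar_patch K L" "h = polar_metric lam"
    and rho: "smooth_on I \<rho>"
    and phi: "\<phi> = polar_map \<rho> k"
    and proper: "proper_biharmonic_map M g N h \<phi>"
    and tension: "\<forall>x\<in>M. metric_norm h (\<phi> x) (tension_field g h \<phi> x) \<noteq> 0"
    and constants: "C1\<^sup>2 + C2\<^sup>2 \<noteq> 0"
    and antiderivative: "\<forall>r\<in>I. (F has_real_derivative
        (deriv (deriv \<rho>) r + deriv \<sigma> r / \<sigma> r * deriv \<rho> r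
          - k\<^sup>2 * lam (\<rho> r) * deriv lam (\<rho> r) / (\<sigma> r)\<^sup>2) powi (-2) * (\<sigma> r) powi (-1)) (at r)"
    and f: "f = (\<lambda>x. C1 + C2 * F (x $ 1))" "\<forall>x\<in>M. f x > 0"
  shows "\<not> harmonic_map M g N h \<phi> \<and> f_biharmonic_map f M g N h \<phi>"
proof
  show "\<not> harmonic_map M g N h \<phi>" using proper by (simp add: proper_biharmonic_map_def)
  from proper have smooth_map: "smooth_riemannian_map M g N h \<phi>"
    and bitension: "\<And>x. x \<in> M \<Longrightarrow> bitension_field g h \<phi> x = 0"
    by (auto simp: proper_biharmonic_map_def biharmonic_map_def)
  show "f_biharmonic_map f M g N h \<phi>"
    \<comment> \<open>Over an empty \<open>J\<close> the patch is empty, and the map carries no information about \<open>\<rho>\<close>: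
      \<open>\<rho> ` I \<subseteq> K\<close> and the nonvanishing of \<open>y\<close> are only available over a nonempty \<open>J\<close>.\<close>
  proof (cases "J = {}")
    case True
    then have "M = {}" by (simp add: M polar_patch_def)
    with smooth_map show ?thesis by (simp add: f_biharmonic_map_def smooth_on_def)
  next
    case False
    then obtain \<theta> where \<theta>: "\<theta> \<in> J" by auto
    have in_M: "vector [r, \<theta>] \<in> M" if "r \<in> I" for r
      using that \<theta> by (simp add: M polar_patch_def)
    have "\<rho> ` I \<subseteq> K"
    proof
      fix s assume "s \<in> \<rho> ` I"
      then obtain r where r: "r \<in> I" "s = \<rho> r" by auto
      with smooth_map in_M have "\<phi> (vector [r, \<theta>]) \<in> N" by (auto simp: smooth_riemannian_map_def)
      then show "s \<in> K" using r by (simp add: N phi polar_patch_def polar_map_def)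
    qed
    then interpret P: polar_map_data I K \<sigma> lam \<rho> k
      using intervals sigma lam rho by unfold_locales (auto intro: smooth_on_imp_times_differentiable_on)
    let ?y = P.radial_tension
    have y: "?y r \<noteq> 0" if "r \<in> I" for r
    proof
      assume "?y r = 0"
      then have "tension_field g h \<phi> (vector [r, \<theta>]) = 0"
        using that P.tension_field_polar_map[of "vector [r, \<theta>]"]
        by (simp add: M N phi vec_eq_iff forall_2)
      with tension in_M[OF that] show False by (auto simp: metric_norm_def)
    qed
    define G where "G r = C1 + C2 * F r" for r
    define G' where "G' r = C2 * (inverse (?y r * ?y r) * inverse (\<sigma> r))" for r
    have fG: "f = (\<lambda>x. G (x $ 1))" by (simp add: f G_def)
    have G: "\<forall>r\<in>I. (G has_real_derivative G' r) (at r)"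
    proof
      fix r assume "r \<in> I"
      with antiderivative have "(F has_real_derivative ?y r powi (-2) * \<sigma> r powi (-1)) (at r)"
        unfolding P.radial_tension_def by blast
      then have "(F has_real_derivative inverse (?y r * ?y r) * inverse (\<sigma> r)) (at r)"
        by (simp add: power_int_minus power2_eq_square)
      then show "(G has_real_derivative G' r) (at r)"
        unfolding G_def G'_def by (auto intro!: derivative_eq_intros)
    qed
    have "times_differentiable_on n I G'" for n
      unfolding G'_def using y P.pos(1)
      by (intro times_differentiable_on_mult times_differentiable_on_inverse
          times_differentiable_on_const P.smooth P.times_differentiable_on_radial_tension) force+
    with G have G_smooth: "times_differentiable_on n I G" for n
      by (cases n) auto
    have "smooth_on M f"
      unfolding fG using smooth_map
      by (intro smooth_on_coordinate[OF _ _ G_smooth])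
        (auto simp: smooth_riemannian_map_def riemannian_domain_def M polar_patch_def)
    moreover have "f x *\<^sub>R bitension_field g h \<phi> x + laplacian g f x *\<^sub>R tension_field g h \<phi> x
        + 2 *\<^sub>R pullback_conn h \<phi> (gradient g f) (tension_field g h \<phi>) x = 0" if "x \<in> M" for x
    proof -
      have x: "x $ 1 \<in> I" using that by (simp add: M polar_patch_def)
      have y': "(?y has_real_derivative deriv ?y (x $ 1)) (at (x $ 1))"
        using times_differentiable_on_imp_DERIV[OF P.times_differentiable_on_radial_tension x] .
      have "\<sigma> (x $ 1) \<noteq> 0" using P.pos(1)[OF x] by simp
      from radial_ode_solution[OF y' P.DERIVs(1)[OF x] y[OF x] this, of C2]
      obtain G'' where "(G' has_real_derivative G'') (at (x $ 1))"
        "(G'' + deriv \<sigma> (x $ 1) / \<sigma> (x $ 1) * G' (x $ 1)) * ?y (x $ 1)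
           + 2 * (G' (x $ 1) * deriv ?y (x $ 1)) = 0"
        unfolding G'_def[symmetric] by blast
      with P.f_biharmonic_first_order_part[OF x G] bitension[OF that] show ?thesis
        by (simp add: fG M N phi vec_eq_iff forall_2)
    qed
    ultimately show ?thesis using smooth_map f(2) by (simp add: f_biharmonic_map_def)
  qed
qed

end
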